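(* Let $P:\mathbb{R}^n\to\mathbb{R}^n$ be a self-adjoint nonexpansive linear operator, let $q\in\mathbb{R}^n$, and let $f_1(x)=\tfrac12\langle Px,x\rangle+\langle q,x\rangle$ and $S_1x=\nabla f_1(x)=Px+q$. Let $f_2:\mathbb{R}^n\to\mathbb{R}$ be differentiable such that $S_2=\nabla f_2$ is nonexpansive and, moreover, $\alpha$-averaged and $\beta$-negatively averaged with $\alpha\in(0,1]$ and $\beta\in(0,1]$. Let $\delta_\alpha=2\alpha-1$ and $\delta_\beta=2\beta-1$. Then the envelope function $$F(x)=\tfrac12\langle Px,x\rangle-f_2(\nabla f_1(x))$$ satisfies $$F(x)-F(y)-\langle\nabla F(y),x-y\rangle\ \geq\ \tfrac12\langle(P-\delta_\beta P^2)(x-y),x-y\rangle$$ and $$F(x)-F(y)-\langle\nabla F(y),x-y\rangle\ \leq\ \tfrac12\langle(P+\delta_\alpha P^2)(x-y),x-y\rangle$$ for all $x,y\in\mathbb{R}^n$.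
   Context: $\langle\cdot,\cdot\rangle$ is an inner product on $\mathbb{R}^n$ with induced norm $\|\cdot\|$; gradients and adjoints are taken with respect to it. A mapping $T:\mathbb{R}^n\to\mathbb{R}^n$ is nonexpansive if $\|Tx-Ty\|\le\|x-y\|$ for all $x,y$. $T$ is $\alpha$-averaged, $\alpha\in(0,1]$, if $T=(1-\alpha)\mathrm{Id}+\alpha R$ for some nonexpansive $R:\mathbb{R}^n\to\mathbb{R}^n$ (so $1$-averaged means nonexpansive). $T$ is $\beta$-negatively averaged, $\beta\in(0,1]$, if $-T$ is $\beta$-averaged. *)

theory Defs
  imports "HOL-Analysis.Analysis"
begin

definition nonexpansive :: "('a::real_normed_vector \<Rightarrow> 'a) \<Rightarrow> bool" where
  "nonexpansive T \<longleftrightarrow> (\<forall>x y. norm (T x - T y) \<le> norm (x - y))"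

definition averaged :: "real \<Rightarrow> ('a::real_normed_vector \<Rightarrow> 'a) \<Rightarrow> bool" where
  "averaged \<alpha> T \<longleftrightarrow>
     0 < \<alpha> \<and> \<alpha> \<le> 1 \<and>
     (\<exists>R. nonexpansive R \<and> (\<forall>x. T x = (1 - \<alpha>) *\<^sub>R x + \<alpha> *\<^sub>R R x))"

definition negatively_averaged :: "real \<Rightarrow> ('a::real_normed_vector \<Rightarrow> 'a) \<Rightarrow> bool" where
  "negatively_averaged \<beta> T \<longleftrightarrow> averaged \<beta> (\<lambda>x. - T x)"

(* Gradient with respect to the inner product of the space. The value is meaningful
   only where the function is differentiable, so statements using it should also
   assert or assume differentiability. *)
definition grad :: "('a::real_inner \<Rightarrow> real) \<Rightarrow> 'a \<Rightarrow> 'a" where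
  "grad f x = (THE D. GDERIV f x :> D)"

end

theory Submission
  imports Defs
begin

text \<open>
  Averagedness of a gradient is a one-sided Lipschitz condition: it bounds
  \<open>(S\<^sub>2 u - S\<^sub>2 v) \<bullet> (u - v)\<close> by multiples of \<open>\<parallel>u - v\<parallel>\<^sup>2\<close>, and integrating along the segment
  from \<open>v\<close> to \<open>u\<close> gives quadratic bounds on \<open>f\<^sub>2 u - f\<^sub>2 v - S\<^sub>2 v \<bullet> (u - v)\<close>. For \<open>u = P x + q\<close> and
  \<open>v = P y + q\<close> this quantity is exactly the difference between \<open>(P (x - y) \<bullet> (x - y)) / 2\<close>
  and the Bregman remainder of \<open>F\<close>, since the gradient of \<open>F\<close> at \<open>y\<close> is \<open>P y - P (S\<^sub>2 v)\<close>.
\<close>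

lemma grad_eqI:
  assumes "GDERIV f x :> D"
  shows "grad f x = D"
  unfolding grad_def
proof (rule the_equality)
  fix E assume "GDERIV f x :> E"
  with assms have "(\<lambda>h. h \<bullet> E) = (\<lambda>h. h \<bullet> D)"
    unfolding gderiv_def by (rule has_derivative_unique[rotated])
  then show "E = D"
    using vector_eq_ldot[of E D] by (simp add: fun_eq_iff)
qed (fact assms)

text \<open>Riesz representation in finite dimension: the derivative \<open>f'\<close> is a linear
  functional, and its adjoint at the scalar 1 is the vector representing it.\<close>

lemma GDERIV_grad:
  fixes f :: "'a::euclidean_space \<Rightarrow> real"
  assumes "f differentiable (at x)"
  shows "GDERIV f x :> grad f x"
proof -
  obtain f' where f': "(f has_derivative f') (at x)"
    using assms by (auto simp: differentiable_def)
  then have "f' h = h \<bullet> adjoint f' 1" for h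
    using adjoint_works[OF has_derivative_linear[OF f'], of h 1] by simp
  then have "f' = (\<lambda>h. h \<bullet> adjoint f' 1)"
    by (rule ext)
  with f' have "GDERIV f x :> adjoint f' 1"
    by (simp add: gderiv_def)
  then show ?thesis
    using grad_eqI by metis
qed

lemma GDERIV_imp_differentiable: "GDERIV f x :> D \<Longrightarrow> f differentiable (at x)"
  by (auto simp: gderiv_def differentiable_def)

text \<open>By Cauchy-Schwarz the nonexpansive part contributes at worst -\<alpha> times the squared
  norm, while the identity part contributes exactly 1 - \<alpha> times it; the sum of the
  coefficients is 1 - 2\<alpha>.\<close>

lemma averaged_inner_ge:
  fixes T :: "'a::real_inner \<Rightarrow> 'a"
  assumes "averaged \<alpha> T"
  shows "(T x - T y) \<bullet> (x - y) \<ge> - (2 * \<alpha> - 1) * (norm (x - y))\<^sup>2"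
proof -
  obtain R where \<alpha>: "0 < \<alpha>" and R: "nonexpansive R"
    and T: "\<And>x. T x = (1 - \<alpha>) *\<^sub>R x + \<alpha> *\<^sub>R R x"
    using assms by (auto simp: averaged_def)
  have "- ((R x - R y) \<bullet> (x - y)) \<le> norm (R x - R y) * norm (x - y)"
    using Cauchy_Schwarz_ineq2[of "R x - R y" "x - y"] by linarith
  also have "\<dots> \<le> (norm (x - y))\<^sup>2"
    using R by (simp add: nonexpansive_def power2_eq_square mult_right_mono)
  finally have "\<alpha> * ((R x - R y) \<bullet> (x - y)) \<ge> - \<alpha> * (norm (x - y))\<^sup>2"
    using \<alpha> mult_left_mono[of "- (norm (x - y))\<^sup>2" "(R x - R y) \<bullet> (x - y)" \<alpha>] by simp
  moreover have "T x - T y = (1 - \<alpha>) *\<^sub>R (x - y) + \<alpha> *\<^sub>R (R x - R y)"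
    by (simp add: T algebra_simps)
  then have "(T x - T y) \<bullet> (x - y) = (1 - \<alpha>) * (norm (x - y))\<^sup>2 + \<alpha> * ((R x - R y) \<bullet> (x - y))"
    by (simp only: inner_add_left inner_scaleR_left power2_norm_eq_inner)
  ultimately show ?thesis
    by (simp add: algebra_simps)
qed

text \<open>A descent lemma under a one-sided condition. The constant \<open>c\<close> may have
  either sign, as \<open>2 * \<alpha> - 1\<close> and \<open>2 * \<beta> - 1\<close> do.\<close>

lemma gradient_upper_bound:
  fixes f :: "'a::real_inner \<Rightarrow> real"
  assumes f: "\<And>x. GDERIV f x :> g x"
    and g: "\<And>x y. (g x - g y) \<bullet> (x - y) \<le> c * (norm (x - y))\<^sup>2"
  shows "f x - f y - g y \<bullet> (x - y) \<le> c / 2 * (norm (x - y))\<^sup>2"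
proof -
  define w where "w = x - y"
  \<comment> \<open>Restriction of \<open>f\<close> to the segment minus the linear and quadratic
    terms of its model at \<open>y\<close>. The claim is \<open>\<phi> 1 \<le> \<phi> 0\<close>, so
    a sign of the derivative replaces the integral.\<close>
  define \<phi> where "\<phi> t = f (y + t *\<^sub>R w) - t * (g y \<bullet> w) - c / 2 * t\<^sup>2 * (norm w)\<^sup>2" for t
  have D: "(\<phi> has_real_derivative (g (y + t *\<^sub>R w) - g y) \<bullet> w - c * t * (norm w)\<^sup>2) (at t)" for t
  proof -
    have "((\<lambda>s. y + s *\<^sub>R w) has_derivative (\<lambda>h. h *\<^sub>R w)) (at t)"
      by (auto intro!: derivative_eq_intros)
    then have "((\<lambda>s. f (y + s *\<^sub>R w)) has_derivative (\<lambda>h. (h *\<^sub>R w) \<bullet> g (y + t *\<^sub>R w))) (at t)"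
      using has_derivative_compose f unfolding gderiv_def by blast
    then have "((\<lambda>s. f (y + s *\<^sub>R w)) has_real_derivative g (y + t *\<^sub>R w) \<bullet> w) (at t)"
      by (rule has_derivative_imp_has_field_derivative) (simp add: inner_commute)
    then show ?thesis
      unfolding \<phi>_def
      by (auto intro!: derivative_eq_intros simp: algebra_simps)
  qed
  have "\<phi> 1 \<le> \<phi> 0"
  proof (rule DERIV_nonpos_imp_nonincreasing[where f = \<phi>])
    fix t :: real assume t: "0 \<le> t" "t \<le> 1"
    \<comment> \<open>The hypothesis pairs the gradient difference with
      \<open>t *\<^sub>R w\<close>, so a factor \<open>t\<close> must be cancelled; at
      \<open>t = 0\<close> both sides vanish.\<close>
    have "(g (y + t *\<^sub>R w) - g y) \<bullet> w \<le> c * t * (norm w)\<^sup>2"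
    proof (cases "t = 0")
      case False
      have "t * ((g (y + t *\<^sub>R w) - g y) \<bullet> w) \<le> t * (c * t * (norm w)\<^sup>2)"
        using g[of "y + t *\<^sub>R w" y] by (simp add: power_mult_distrib power2_eq_square ac_simps)
      then show ?thesis
        using False t by simp
    qed simp
    then show "\<exists>d. (\<phi> has_real_derivative d) (at t) \<and> d \<le> 0"
      using D[of t] by (intro exI[of _ "(g (y + t *\<^sub>R w) - g y) \<bullet> w - c * t * (norm w)\<^sup>2"]) simp
  qed simp
  then show ?thesis
    by (simp add: \<phi>_def w_def)
qed

theorem theorem3p1:
  fixes P S1 S2 :: "'a::euclidean_space \<Rightarrow> 'a"
    and q :: 'a
    and f1 f2 F :: "'a \<Rightarrow> real"
    and \<alpha> \<beta> \<delta>\<^sub>\<alpha> \<delta>\<^sub>\<beta> :: real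
  assumes "linear P" and "adjoint P = P" and "nonexpansive P"
    and "\<And>x. f1 x = 1/2 * (P x \<bullet> x) + q \<bullet> x"
    and "\<And>x. S1 x = grad f1 x"
    and "\<And>x. f2 differentiable (at x)"
    and "\<And>x. S2 x = grad f2 x"
    and "nonexpansive S2"
    and "\<alpha> \<in> {0<..1}" and "averaged \<alpha> S2"
    and "\<beta> \<in> {0<..1}" and "negatively_averaged \<beta> S2"
    and "\<delta>\<^sub>\<alpha> = 2 * \<alpha> - 1" and "\<delta>\<^sub>\<beta> = 2 * \<beta> - 1"
    and "\<And>x. F x = 1/2 * (P x \<bullet> x) - f2 (grad f1 x)"
  shows "(\<forall>x. f1 differentiable (at x) \<and> S1 x = P x + q) \<and>
         (\<forall>x. F differentiable (at x)) \<and>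
         (\<forall>x y. F x - F y - grad F y \<bullet> (x - y)
                  \<ge> 1/2 * ((P (x - y) - \<delta>\<^sub>\<beta> *\<^sub>R (P ^^ 2) (x - y)) \<bullet> (x - y))) \<and>
         (\<forall>x y. F x - F y - grad F y \<bullet> (x - y)
                  \<le> 1/2 * ((P (x - y) + \<delta>\<^sub>\<alpha> *\<^sub>R (P ^^ 2) (x - y)) \<bullet> (x - y)))"
proof -
  have sym: "P x \<bullet> y = x \<bullet> P y" for x y
    using adjoint_works[OF assms(1), of x y] assms(2) by (simp add: inner_commute)
  have P': "(P has_derivative P) (at x)" for x
    using assms(1) by (simp add: linear_imp_has_derivative)
  \<comment> \<open>The product rule yields two terms that self-adjointness makes equal, which
    absorbs the factor 1/2.\<close>
  have quad: "GDERIV (\<lambda>x. 1/2 * (P x \<bullet> x)) x :> P x" for x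
  proof -
    have "((\<lambda>x. 1/2 * (P x \<bullet> x)) has_derivative (\<lambda>h. 1/2 * (P x \<bullet> h + P h \<bullet> x))) (at x)"
      by (intro has_derivative_mult_right has_derivative_inner P' has_derivative_ident)
    then show ?thesis
      by (simp add: gderiv_def sym[of _ x] inner_commute[of "P x"])
  qed
  have f1': "GDERIV f1 x :> P x + q" for x
  proof -
    have "GDERIV (\<lambda>x. q \<bullet> x) x :> q"
      unfolding gderiv_def by (auto intro!: derivative_eq_intros simp: fun_eq_iff inner_commute)
    then have "GDERIV (\<lambda>x. 1/2 * (P x \<bullet> x) + q \<bullet> x) x :> P x + q"
      by (rule GDERIV_add[OF quad])
    then show ?thesis
      by (simp add: assms(4)[abs_def])
  qed
  have grad_f1: "grad f1 x = P x + q" for x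
    by (rule grad_eqI[OF f1'])
  have f2': "GDERIV f2 x :> S2 x" for x
    using GDERIV_grad[OF assms(6)] assms(7) by simp
  have F': "GDERIV F x :> P x - P (S2 (P x + q))" for x
  proof -
    have "((\<lambda>x. P x + q) has_derivative P) (at x)"
      using P' by (auto intro!: derivative_eq_intros)
    then have "((\<lambda>x. f2 (P x + q)) has_derivative (\<lambda>h. P h \<bullet> S2 (P x + q))) (at x)"
      using has_derivative_compose f2' unfolding gderiv_def by blast
    then have "GDERIV (\<lambda>x. f2 (P x + q)) x :> P (S2 (P x + q))"
      by (simp add: gderiv_def sym)
    then have "GDERIV (\<lambda>x. 1/2 * (P x \<bullet> x) - f2 (P x + q)) x :> P x - P (S2 (P x + q))"
      by (rule GDERIV_diff[OF quad])
    then show ?thesis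
      by (simp add: assms(15)[abs_def] grad_f1)
  qed
  \<comment> \<open>A lower bound on the monotonicity of \<open>- S2\<close> is an upper bound on
    that of \<open>S2\<close>, hence \<beta> governs this side.\<close>
  have upper: "f2 u - f2 v - S2 v \<bullet> (u - v) \<le> \<delta>\<^sub>\<beta> / 2 * (norm (u - v))\<^sup>2" for u v
  proof (rule gradient_upper_bound[OF f2'])
    show "(S2 x - S2 y) \<bullet> (x - y) \<le> \<delta>\<^sub>\<beta> * (norm (x - y))\<^sup>2" for x y
      using averaged_inner_ge[OF assms(12)[unfolded negatively_averaged_def], of x y]
      unfolding assms(14)
      by (simp add: algebra_simps)
  qed
  \<comment> \<open>The same descent lemma applied to \<open>- f2\<close>.\<close>
  have lower: "f2 u - f2 v - S2 v \<bullet> (u - v) \<ge> - (\<delta>\<^sub>\<alpha> / 2 * (norm (u - v))\<^sup>2)" for u v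
  proof -
    have "GDERIV (\<lambda>x. - f2 x) x :> - S2 x" for x
      using f2' by (rule GDERIV_minus)
    moreover have "(- S2 x - - S2 y) \<bullet> (x - y) \<le> \<delta>\<^sub>\<alpha> * (norm (x - y))\<^sup>2" for x y
      using averaged_inner_ge[OF assms(10), of x y]
      unfolding assms(13)
      by (simp add: algebra_simps)
    ultimately have "- f2 u - - f2 v - (- S2 v) \<bullet> (u - v) \<le> \<delta>\<^sub>\<alpha> / 2 * (norm (u - v))\<^sup>2"
      by (rule gradient_upper_bound)
    then show ?thesis
      by simp
  qed
  \<comment> \<open>Self-adjointness turns the squared norm into the quadratic form of the square of
    \<open>P\<close>, the source of that term in both bounds.\<close>
  have norm_P: "(norm (P d))\<^sup>2 = (P ^^ 2) d \<bullet> d" for d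
    unfolding power2_norm_eq_inner by (simp add: numeral_2_eq_2 sym[of "P d"])
  have remainder: "F x - F y - grad F y \<bullet> (x - y) = 1/2 * (P (x - y) \<bullet> (x - y))
      - (f2 (P x + q) - f2 (P y + q) - S2 (P y + q) \<bullet> ((P x + q) - (P y + q)))" for x y
  proof -
    \<comment> \<open>Symmetry of the cross terms collapses the quadratic part to the form at
      \<open>x - y\<close>.\<close>
    have "P y \<bullet> x = P x \<bullet> y"
      by (metis sym inner_commute)
    then show ?thesis
      by (simp add: grad_eqI[OF F'] assms(15) grad_f1 linear_diff[OF assms(1)] sym[of "S2 _"]
          inner_diff_left inner_diff_right)
  qed
  have diff: "(P x + q) - (P y + q) = P (x - y)" for x y
    by (simp add: linear_diff[OF assms(1)])
  \<comment> \<open>The \<open>f2\<close> remainder enters with a minus sign, so its upper bound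
    becomes the lower bound for \<open>F\<close>, and conversely.\<close>
  have "F x - F y - grad F y \<bullet> (x - y)
      \<ge> 1/2 * ((P (x - y) - \<delta>\<^sub>\<beta> *\<^sub>R (P ^^ 2) (x - y)) \<bullet> (x - y))" for x y
    using upper[of "P x + q" "P y + q"]
    unfolding remainder diff norm_P by (simp add: inner_diff_left algebra_simps)
  moreover have "F x - F y - grad F y \<bullet> (x - y)
      \<le> 1/2 * ((P (x - y) + \<delta>\<^sub>\<alpha> *\<^sub>R (P ^^ 2) (x - y)) \<bullet> (x - y))" for x y
    using lower[where u = "P x + q" and v = "P y + q"]
    unfolding remainder diff norm_P by (simp add: inner_add_left algebra_simps)
  ultimately show ?thesis
    using GDERIV_imp_differentiable[OF f1'] GDERIV_imp_differentiable[OF F'] grad_f1 assms(5)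
    by simp
qed

end
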